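(* Let $\Omega\subseteq\mathbb{R}^N$, let $(\bm x_1,f_1),\ldots,(\bm x_m,f_m)$ be given observations with $\bm x_i\in\Omega$ and $f_i\in\mathbb{R}$, and let $\omega_1,\ldots,\omega_m>0$ be weights. Let $V=\operatorname{span}\{\beta_1,\ldots,\beta_n\}$ be an $n$-dimensional real vector space of functions on $\Omega$, with basis functions $\beta_j:\Omega\to\mathbb{R}$ and $n\le m$. The weighted least squares approximant $v\in V$ of the set of points $\{(\bm x_i,f_i)\}_{i=1}^m$, i.e. the minimizer over $u\in V$ of $$\sum_{i=1}^m\omega_i\,|u(\bm x_i)-f_i|^2,$$ is the weighted sum of the interpolants $v_K\in V$, for $K\in\mathcal{P}_n^\star$, which interpolate the points $(\bm x_i,f_i)$ for $i\in K$, namely $$v(\bm x)=\frac{\sum_{K\in\mathcal{P}_n^\star}\lambda_K\,v_K(\bm x)}{\sum_{K\in\mathcal{P}_n^\star}\lambda_K}\qquad\text{for all }\bm x\in\Omega .$$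
   Context: For $K=\{k_1,\ldots,k_n\}\subseteq\{1,\ldots,m\}$ with $\#(K)=n$ (elements listed in a fixed order, e.g. increasing), the collocation matrix at the points $\bm x_{k_1},\ldots,\bm x_{k_n}$ is the matrix $B_K\in\mathbb{R}^{n\times n}$ whose $(i,j)$ entry is $\beta_j(\bm x_{k_i})$, and $|B_K|$ denotes its determinant. Define $\mathcal{P}_n^\star=\{K\subseteq\{1,\ldots,m\}:\#(K)=n,\ |B_K|\neq 0\}$. For $K\in\mathcal{P}_n^\star$, $v_K$ is the unique element of $V$ satisfying $v_K(\bm x_i)=f_i$ for all $i\in K$. Set $\omega_K=\prod_{i\in K}\omega_i$ and $\lambda_K=\omega_K|B_K|^2$.
   Formalization: It is additionally assumed that $\mathcal{P}_n^\star$ is non-empty; otherwise (e.g. $\beta_1=1,\beta_2=t$, $n=m=2$, $x_1=x_2$) the quotient is $0/0$ and the minimizer is not unique. *)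

theory Defs
  imports
    "HOL-Analysis.Finite_Cartesian_Product"
    "HOL-Library.Function_Algebras"
    "Jordan_Normal_Form.Determinant"
begin

definition fun_scale :: "real \<Rightarrow> ('a \<Rightarrow> real) \<Rightarrow> 'a \<Rightarrow> real" where
  "fun_scale c g = (\<lambda>x. c * g x)"

interpretation fun_space: vector_space fun_scale
  by unfold_locales (auto simp: fun_scale_def fun_eq_iff algebra_simps)

(* Real functions on \<Omega> are encoded as total functions that vanish outside \<Omega>. These
   form a linear subspace of the full function space, so span and dim are the usual ones, and
   two such functions are equal iff they agree on \<Omega>. *)
definition on_dom :: "'a set \<Rightarrow> ('a \<Rightarrow> real) \<Rightarrow> 'a \<Rightarrow> real" where
  "on_dom \<Omega> g = (\<lambda>x. if x \<in> \<Omega> then g x else 0)"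

definition approx_space :: "'a set \<Rightarrow> nat \<Rightarrow> (nat \<Rightarrow> 'a \<Rightarrow> real) \<Rightarrow> ('a \<Rightarrow> real) set" where
  "approx_space \<Omega> n \<beta> = fun_space.span ((\<lambda>j. on_dom \<Omega> (\<beta> j)) ` {1..n})"

(* Points and basis functions are numbered from 1, matrix rows and columns from 0; the elements
   of K are listed in increasing order. *)
definition colloc_mat :: "nat \<Rightarrow> (nat \<Rightarrow> 'a \<Rightarrow> real) \<Rightarrow> (nat \<Rightarrow> 'a) \<Rightarrow> nat set \<Rightarrow> real Matrix.mat" where
  "colloc_mat n \<beta> x K =
     Matrix.mat n n (\<lambda>(i, j). \<beta> (Suc j) (x (sorted_list_of_set K ! i)))"

definition unisolvent_sets :: "nat \<Rightarrow> nat \<Rightarrow> (nat \<Rightarrow> 'a \<Rightarrow> real) \<Rightarrow> (nat \<Rightarrow> 'a) \<Rightarrow> nat set set" where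
  "unisolvent_sets m n \<beta> x =
     {K. K \<subseteq> {1..m} \<and> card K = n \<and> Determinant.det (colloc_mat n \<beta> x K) \<noteq> 0}"

definition interpolant ::
    "('a \<Rightarrow> real) set \<Rightarrow> (nat \<Rightarrow> 'a) \<Rightarrow> (nat \<Rightarrow> real) \<Rightarrow> nat set \<Rightarrow> 'a \<Rightarrow> real" where
  "interpolant V x f K = (THE u. u \<in> V \<and> (\<forall>i\<in>K. u (x i) = f i))"

definition wls_coeff ::
    "nat \<Rightarrow> (nat \<Rightarrow> 'a \<Rightarrow> real) \<Rightarrow> (nat \<Rightarrow> 'a) \<Rightarrow> (nat \<Rightarrow> real) \<Rightarrow> nat set \<Rightarrow> real" where
  "wls_coeff n \<beta> x \<omega> K = (\<Prod>i\<in>K. \<omega> i) * (Determinant.det (colloc_mat n \<beta> x K))\<^sup>2"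

definition wls_approximant ::
    "('a \<Rightarrow> real) set \<Rightarrow> nat \<Rightarrow> (nat \<Rightarrow> 'a) \<Rightarrow> (nat \<Rightarrow> real) \<Rightarrow> (nat \<Rightarrow> real) \<Rightarrow> ('a \<Rightarrow> real) \<Rightarrow> bool"
  where
  "wls_approximant V m x f \<omega> v \<longleftrightarrow>
     is_arg_min (\<lambda>u. \<Sum>i = 1..m. \<omega> i * \<bar>u (x i) - f i\<bar>\<^sup>2) (\<lambda>u. u \<in> V) v"

end

theory Submission imports Defs begin

text \<open>
  The classical route solves the normal equations by Cramer's rule and expands both determinants by
  the Cauchy-Binet formula. Here the weighted mean \<open>v = (\<Sum>K. \<lambda>\<^sub>K v\<^sub>K) / (\<Sum>K. \<lambda>\<^sub>K)\<close> is instead shown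
  directly to satisfy the normal equations, that is, its residual at the data points is
  \<open>\<omega>\<close>-orthogonal to every \<open>u \<in> V\<close> (\<open>normal_equations_interpolant_sum\<close>).

  The summand of \<open>\<Sum>K. \<lambda>\<^sub>K \<Sum>i. \<omega>\<^sub>i (v\<^sub>K(x\<^sub>i) - f\<^sub>i) u(x\<^sub>i)\<close> vanishes for \<open>i \<in> K\<close>, so the pairs \<open>(K, i)\<close>
  with \<open>i \<notin> K\<close> remain; group them by the set \<open>L = K \<union> {i}\<close> of \<open>n + 1\<close> indices. The weights in one
  group have the common product \<open>\<omega>\<^sub>L\<close>, and what is left to show is
  \<open>(\<Sum>i\<in>L. d\<^sub>i\<^sup>2 (v\<^bsub>L-{i}\<^esub>(x\<^sub>i) - f\<^sub>i) u(x\<^sub>i)) = 0\<close> where \<open>d\<^sub>i = \<plusminus>|B\<^bsub>L-{i}\<^esub>|\<close>. With the signs of a Laplace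
  expansion, the functional \<open>E(g) = (\<Sum>i\<in>L. d\<^sub>i g\<^sub>i)\<close> is the determinant of the collocation
  matrix at \<open>L\<close> bordered by the column \<open>g\<close>, and hence annihilates the values of every element of
  \<open>V\<close> (\<open>signed_minors_annihilate_basis\<close>). Since \<open>v\<^bsub>L-{i}\<^esub> - f\<close> vanishes on \<open>L\<close> except at \<open>i\<close>, the
  product \<open>d\<^sub>i (v\<^bsub>L-{i}\<^esub>(x\<^sub>i) - f\<^sub>i)\<close> equals \<open>E(v\<^bsub>L-{i}\<^esub> - f) = - E(f)\<close>, which is the same for all \<open>i\<close>.
  Therefore the sum is \<open>- E(f) E(u) = 0\<close> (\<open>exchange_sum_zero\<close>).

  Orthogonality turns the objective into a Pythagorean sum, so \<open>v\<close> is a minimizer, and any other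
  minimizer agrees with \<open>v\<close> at all data points, in particular on a unisolvent set, hence
  everywhere.
\<close>

section \<open>The approximation space and interpolation\<close>

lemma approx_space_iff:
  "u \<in> approx_space \<Omega> n \<beta> \<longleftrightarrow> (\<exists>c. u = (\<lambda>y. \<Sum>j = 1..n. c j * on_dom \<Omega> (\<beta> j) y))"
proof
  let ?S = "{u. \<exists>c. u = (\<lambda>y. \<Sum>j = 1..n. c j * on_dom \<Omega> (\<beta> j) y)}"
  have "fun_space.subspace ?S"
    unfolding fun_space.subspace_def
  proof (intro conjI ballI allI)
    show "0 \<in> ?S"
      by (auto simp: fun_eq_iff intro!: exI[of _ "\<lambda>_. 0"])
  next
    fix u w assume "u \<in> ?S" "w \<in> ?S"
    then obtain c d where "u = (\<lambda>y. \<Sum>j = 1..n. c j * on_dom \<Omega> (\<beta> j) y)"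
      "w = (\<lambda>y. \<Sum>j = 1..n. d j * on_dom \<Omega> (\<beta> j) y)" by auto
    then show "u + w \<in> ?S"
      by (auto simp: fun_eq_iff sum.distrib ring_distribs intro!: exI[of _ "\<lambda>j. c j + d j"])
  next
    fix a u assume "u \<in> ?S"
    then obtain c where "u = (\<lambda>y. \<Sum>j = 1..n. c j * on_dom \<Omega> (\<beta> j) y)" by auto
    then show "fun_scale a u \<in> ?S"
      by (auto simp: fun_scale_def fun_eq_iff sum_distrib_left mult.assoc
          intro!: exI[of _ "\<lambda>j. a * c j"])
  qed
  moreover have "(\<lambda>j. on_dom \<Omega> (\<beta> j)) ` {1..n} \<subseteq> ?S"
  proof
    fix u assume "u \<in> (\<lambda>j. on_dom \<Omega> (\<beta> j)) ` {1..n}"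
    then obtain k where "k \<in> {1..n}" "u = on_dom \<Omega> (\<beta> k)" by auto
    then have "u = (\<lambda>y. \<Sum>j = 1..n. (if j = k then 1 else 0) * on_dom \<Omega> (\<beta> j) y)"
      by (simp add: if_distrib[of "\<lambda>c. c * _"] cong: if_cong)
    then show "u \<in> ?S" by (intro CollectI exI)
  qed
  ultimately have "approx_space \<Omega> n \<beta> \<subseteq> ?S"
    unfolding approx_space_def by (intro fun_space.span_minimal)
  then show "u \<in> approx_space \<Omega> n \<beta> \<Longrightarrow> \<exists>c. u = (\<lambda>y. \<Sum>j = 1..n. c j * on_dom \<Omega> (\<beta> j) y)"
    by auto
next
  assume "\<exists>c. u = (\<lambda>y. \<Sum>j = 1..n. c j * on_dom \<Omega> (\<beta> j) y)"
  then obtain c where u: "u = (\<lambda>y. \<Sum>j = 1..n. c j * on_dom \<Omega> (\<beta> j) y)" ..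
  have apply_sum: "(\<Sum>j\<in>J. g j) y = (\<Sum>j\<in>J. g j y)"
    for g :: "nat \<Rightarrow> 'a \<Rightarrow> real" and J y
    by (induction J rule: infinite_finite_induct) auto
  have "u = (\<Sum>j = 1..n. fun_scale (c j) (on_dom \<Omega> (\<beta> j)))"
    by (simp add: u fun_eq_iff apply_sum fun_scale_def)
  also have "\<dots> \<in> approx_space \<Omega> n \<beta>"
    unfolding approx_space_def
    by (intro fun_space.span_sum fun_space.span_scale fun_space.span_base) auto
  finally show "u \<in> approx_space \<Omega> n \<beta>" .
qed

lemma approx_space_subspace: "fun_space.subspace (approx_space \<Omega> n \<beta>)"
  by (simp add: approx_space_def fun_space.subspace_span)

lemma approx_space_diff:
  assumes "u \<in> approx_space \<Omega> n \<beta>" "w \<in> approx_space \<Omega> n \<beta>"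
  shows "(\<lambda>y. u y - w y) \<in> approx_space \<Omega> n \<beta>"
  using fun_space.subspace_diff[OF approx_space_subspace assms] by (simp add: fun_diff_def)

lemma approx_space_lincomb:
  assumes "\<And>K. K \<in> U \<Longrightarrow> w K \<in> approx_space \<Omega> n \<beta>"
  shows "(\<lambda>y. \<Sum>K\<in>U. a K * w K y) \<in> approx_space \<Omega> n \<beta>"
proof -
  have "(\<Sum>K\<in>U. fun_scale (a K) (w K)) \<in> approx_space \<Omega> n \<beta>"
    by (intro fun_space.subspace_sum[OF approx_space_subspace]
        fun_space.subspace_scale[OF approx_space_subspace] assms)
  moreover have "(\<Sum>K\<in>U. fun_scale (a K) (w K)) y = (\<Sum>K\<in>U. a K * w K y)" for y
    by (induction U rule: infinite_finite_induct) (auto simp: fun_scale_def)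
  ultimately show ?thesis by (metis (no_types, lifting) ext)
qed

lemma colloc_mat_mult_vec:
  fixes c :: "nat \<Rightarrow> real"
  assumes "i < n"
  shows "(colloc_mat n \<beta> x K *\<^sub>v vec n (\<lambda>j. c (Suc j))) $ i =
    (\<Sum>j = 1..n. c j * \<beta> j (x (sorted_list_of_set K ! i)))"
  using assms
  by (simp add: colloc_mat_def scalar_prod_def sum.atLeast1_atMost_eq lessThan_atLeast0)
    (intro sum.cong refl, simp add: mult.commute)

lemma ex_interpolant:
  assumes K: "finite K" "card K = n" and nz: "Determinant.det (colloc_mat n \<beta> x K) \<noteq> 0"
    and \<Omega>: "\<And>i. i \<in> K \<Longrightarrow> x i \<in> \<Omega>"
  shows "\<exists>u\<in>approx_space \<Omega> n \<beta>. \<forall>i\<in>K. u (x i) = f i"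
proof -
  let ?B = "colloc_mat n \<beta> x K" and ?ks = "sorted_list_of_set K"
  have B: "?B \<in> carrier_mat n n" by (simp add: colloc_mat_def)
  from det_non_zero_imp_unit[OF B nz, of "()"] obtain C where
    C: "C \<in> carrier_mat n n" "?B * C = 1\<^sub>m n"
    by (auto simp: Units_def ring_mat_def)
  define g where "g = vec n (\<lambda>i. f (?ks ! i))"
  define c where "c = (\<lambda>j :: nat. (C *\<^sub>v g) $ (j - 1))"
  have "C *\<^sub>v g = vec n (\<lambda>j. c (Suc j))"
    using C by (auto simp: c_def)
  moreover have "?B *\<^sub>v (C *\<^sub>v g) = g"
    using B C by (simp add: assoc_mult_mat_vec[symmetric] g_def)
  ultimately have sol: "(\<Sum>j = 1..n. c j * \<beta> j (x (?ks ! i))) = f (?ks ! i)" if "i < n" for i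
    using colloc_mat_mult_vec[OF that, of \<beta> x K c] that by (simp add: g_def)
  have "(\<Sum>j = 1..n. c j * on_dom \<Omega> (\<beta> j) (x k)) = f k" if "k \<in> K" for k
  proof -
    from that K obtain i where "i < n" "k = ?ks ! i"
      by (metis in_set_conv_nth set_sorted_list_of_set length_sorted_list_of_set)
    then show ?thesis using sol \<Omega>[OF that] by (simp add: on_dom_def)
  qed
  moreover have "(\<lambda>y. \<Sum>j = 1..n. c j * on_dom \<Omega> (\<beta> j) y) \<in> approx_space \<Omega> n \<beta>"
    unfolding approx_space_iff by (rule exI, rule refl)
  ultimately show ?thesis by (intro bexI[rotated]) auto
qed

text \<open>
  The collocation matrix is injective on coefficient vectors. This gives uniqueness both of the
  interpolants and of the least squares approximant.
\<close>
lemma vanishing_on_unisolvent_imp_zero: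
  assumes K: "finite K" "card K = n" and nz: "Determinant.det (colloc_mat n \<beta> x K) \<noteq> 0"
    and \<Omega>: "\<And>i. i \<in> K \<Longrightarrow> x i \<in> \<Omega>"
    and u: "u \<in> approx_space \<Omega> n \<beta>" and zero: "\<And>i. i \<in> K \<Longrightarrow> u (x i) = 0"
  shows "u y = 0"
proof -
  let ?B = "colloc_mat n \<beta> x K" and ?ks = "sorted_list_of_set K"
  have B: "?B \<in> carrier_mat n n" by (simp add: colloc_mat_def)
  from u obtain c where c: "u = (\<lambda>y. \<Sum>j = 1..n. c j * on_dom \<Omega> (\<beta> j) y)"
    by (auto simp: approx_space_iff)
  define w where "w = vec n (\<lambda>j. c (Suc j))"
  have "?B *\<^sub>v w = 0\<^sub>v n"
  proof (rule eq_vecI)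
    fix i assume "i < dim_vec (0\<^sub>v n :: real vec)"
    then have i: "i < n" by simp
    with K have "?ks ! i \<in> K"
      by (metis nth_mem set_sorted_list_of_set length_sorted_list_of_set)
    with zero[OF this] \<Omega>[OF this] show "(?B *\<^sub>v w) $ i = 0\<^sub>v n $ i"
      using colloc_mat_mult_vec[OF i, of \<beta> x K c] i by (simp add: c w_def on_dom_def)
  qed (use B in simp)
  moreover have "w \<in> carrier_vec n" by (simp add: w_def)
  ultimately have "w = 0\<^sub>v n"
    using det_0_iff_vec_prod_zero_field[OF B] nz by blast
  then have "c j = 0" if "j \<in> {1..n}" for j
  proof -
    from that obtain k where k: "j = Suc k" "k < n" by (cases j) auto
    with \<open>w = 0\<^sub>v n\<close> have "w $ k = 0" by simp
    then show ?thesis using k by (simp add: w_def)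
  qed
  then show ?thesis by (simp add: c)
qed

lemma interpolant_props:
  assumes K: "finite K" "card K = n" and nz: "Determinant.det (colloc_mat n \<beta> x K) \<noteq> 0"
    and \<Omega>: "\<And>i. i \<in> K \<Longrightarrow> x i \<in> \<Omega>"
  shows "interpolant (approx_space \<Omega> n \<beta>) x f K \<in> approx_space \<Omega> n \<beta>"
    and "i \<in> K \<Longrightarrow> interpolant (approx_space \<Omega> n \<beta>) x f K (x i) = f i"
proof -
  let ?P = "\<lambda>u. u \<in> approx_space \<Omega> n \<beta> \<and> (\<forall>i\<in>K. u (x i) = f i)"
  have "\<exists>!u. ?P u"
  proof (rule ex_ex1I)
    show "\<exists>u. ?P u" using ex_interpolant[OF assms, of f] by blast
    fix u w assume uw: "?P u" "?P w"
    have "(\<lambda>y. u y - w y) \<in> approx_space \<Omega> n \<beta>" using uw approx_space_diff by blast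
    from vanishing_on_unisolvent_imp_zero[OF K nz \<Omega> this] uw
    show "u = w" by (auto simp: fun_eq_iff)
  qed
  from theI'[OF this]
  show "interpolant (approx_space \<Omega> n \<beta>) x f K \<in> approx_space \<Omega> n \<beta>"
    and "i \<in> K \<Longrightarrow> interpolant (approx_space \<Omega> n \<beta>) x f K (x i) = f i"
    unfolding interpolant_def by blast+
qed

section \<open>Signed minors and the exchange identity\<close>

lemma sorted_list_of_set_delete_nth:
  assumes "finite L" "i < card L"
  shows "sorted_list_of_set (L - {sorted_list_of_set L ! i}) =
    take i (sorted_list_of_set L) @ drop (Suc i) (sorted_list_of_set L)"
proof -
  let ?l = "sorted_list_of_set L"
  have len: "i < length ?l" using assms by simp
  have "?l ! i \<notin> set (take i ?l)"
    using len distinct_sorted_list_of_set[of L]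
    by (auto simp: in_set_conv_nth nth_eq_iff_index_eq)
  then have "remove1 (?l ! i) (take i ?l @ ?l ! i # drop (Suc i) ?l) = take i ?l @ drop (Suc i) ?l"
    by (simp add: remove1_append)
  then show ?thesis
    using id_take_nth_drop[OF len] assms by (simp add: sorted_list_of_set_remove)
qed

text \<open>
  Border the \<open>(n + 1) \<times> n\<close> collocation matrix at \<open>L\<close> by a copy of its column \<open>j\<close>. The determinant
  is \<open>0\<close>, and the Laplace expansion along the added column is the asserted relation, with
  \<open>s\<close> as the checkerboard signs. Existence of some signs suffices later, because only their squares
  enter.
\<close>
lemma signed_minors_annihilate_basis:
  assumes L: "finite L" "card L = Suc n"
  shows "\<exists>s :: nat \<Rightarrow> real. (\<forall>i\<in>L. s i * s i = 1) \<and>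
    (\<forall>j\<in>{1..n}. (\<Sum>i\<in>L. s i * Determinant.det (colloc_mat n \<beta> x (L - {i})) * \<beta> j (x i)) = 0)"
proof -
  let ?l = "sorted_list_of_set L"
  define pos where "pos = the_inv_into {..<Suc n} ((!) ?l)"
  define s where "s i = (-1 :: real) ^ (pos i + n)" for i
  have bij: "bij_betw ((!) ?l) {..<Suc n} L"
    by (rule bij_betw_nth) (use L in auto)
  have pos: "pos (?l ! i) = i" if "i < Suc n" for i
    using bij that by (auto simp: pos_def bij_betw_def the_inv_into_f_f)
  have "(\<Sum>i\<in>L. s i * Determinant.det (colloc_mat n \<beta> x (L - {i})) * \<beta> j (x i)) = 0"
    if j: "j \<in> {1..n}" for j
  proof -
    define A where "A = Matrix.mat (Suc n) (Suc n)
      (\<lambda>(i, k). \<beta> (if k < n then Suc k else j) (x (?l ! i)))"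
    have A: "A \<in> carrier_mat (Suc n) (Suc n)" by (simp add: A_def)
    have minor: "mat_delete A i n = colloc_mat n \<beta> x (L - {?l ! i})" if "i < Suc n" for i
    proof (rule eq_matI)
      fix r k assume "r < dim_row (colloc_mat n \<beta> x (L - {?l ! i}))"
        "k < dim_col (colloc_mat n \<beta> x (L - {?l ! i}))"
      then have rk: "r < n" "k < n" by (auto simp: colloc_mat_def)
      have "(take i ?l @ drop (Suc i) ?l) ! r = ?l ! (if r < i then r else Suc r)"
        using that rk L by (auto simp: nth_append)
      then show "mat_delete A i n $$ (r, k) = colloc_mat n \<beta> x (L - {?l ! i}) $$ (r, k)"
        using rk that L
        by (auto simp: mat_delete_def A_def colloc_mat_def sorted_list_of_set_delete_nth)
    qed (auto simp: A_def colloc_mat_def)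
    have entry: "A $$ (i, n) = \<beta> j (x (?l ! i))" if "i < Suc n" for i
      using that by (simp add: A_def)
    have "Determinant.det A = 0"
    proof (rule det_identical_columns[OF A, of "j - 1" n])
      show "col A (j - 1) = col A n" using j by (auto simp: A_def)
    qed (use j in auto)
    then have "0 = (\<Sum>i<Suc n. A $$ (i, n) * cofactor A i n)"
      using laplace_expansion_column[OF A, of n] by simp
    also have "\<dots> = (\<Sum>i<Suc n. s (?l ! i) *
        Determinant.det (colloc_mat n \<beta> x (L - {?l ! i})) * \<beta> j (x (?l ! i)))"
      by (intro sum.cong refl) (simp add: cofactor_def minor pos s_def entry)
    also have "\<dots> = (\<Sum>i\<in>L. s i * Determinant.det (colloc_mat n \<beta> x (L - {i})) * \<beta> j (x i))"
      by (rule sum.reindex_bij_betw[OF bij])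
    finally show ?thesis by simp
  qed
  moreover have "s i * s i = 1" for i
    by (simp add: s_def flip: power_add power_mult_distrib)
  ultimately show ?thesis by blast
qed

text \<open>
  The contribution of one \<open>(n + 1)\<close>-element set to the normal equations, without the common factor
  \<open>\<omega>\<^sub>L\<close>. Sets \<open>L - {i}\<close> with singular collocation matrix may be kept in the sum: there the squared
  determinant vanishes, whatever value \<open>interpolant\<close> takes.
\<close>
lemma exchange_sum_zero:
  assumes L: "finite L" "card L = Suc n" and \<Omega>: "\<And>i. i \<in> L \<Longrightarrow> x i \<in> \<Omega>"
    and u: "u \<in> approx_space \<Omega> n \<beta>"
  shows "(\<Sum>i\<in>L. (Determinant.det (colloc_mat n \<beta> x (L - {i})))\<^sup>2 *
    (interpolant (approx_space \<Omega> n \<beta>) x f (L - {i}) (x i) - f i) * u (x i)) = 0"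
proof -
  let ?V = "approx_space \<Omega> n \<beta>" and ?b = "\<lambda>i. Determinant.det (colloc_mat n \<beta> x (L - {i}))"
  obtain s where s: "\<And>i. i \<in> L \<Longrightarrow> s i * s i = 1"
    and s0: "\<And>j. j \<in> {1..n} \<Longrightarrow> (\<Sum>i\<in>L. s i * ?b i * \<beta> j (x i)) = 0"
    using signed_minors_annihilate_basis[OF L, of \<beta> x] by blast
  define d where "d i = s i * ?b i" for i
  have annihilate: "(\<Sum>i\<in>L. d i * w (x i)) = 0" if "w \<in> ?V" for w
  proof -
    obtain c where c: "w = (\<lambda>y. \<Sum>j = 1..n. c j * on_dom \<Omega> (\<beta> j) y)"
      using \<open>w \<in> ?V\<close> by (auto simp: approx_space_iff)
    have "(\<Sum>i\<in>L. d i * w (x i)) = (\<Sum>i\<in>L. \<Sum>j = 1..n. c j * (d i * \<beta> j (x i)))"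
      using \<Omega> by (intro sum.cong refl) (auto simp: c on_dom_def sum_distrib_left mult_ac)
    also have "\<dots> = (\<Sum>j = 1..n. c j * (\<Sum>i\<in>L. d i * \<beta> j (x i)))"
      by (subst sum.swap) (simp add: sum_distrib_left)
    also have "\<dots> = 0"
      using s0 by (simp add: d_def)
    finally show ?thesis .
  qed
  define e where "e = (\<Sum>i\<in>L. d i * f i)"
  have "(?b i)\<^sup>2 * (interpolant ?V x f (L - {i}) (x i) - f i) * u (x i) = - e * (d i * u (x i))"
    if i: "i \<in> L" for i
  proof (cases "?b i = 0")
    case True
    then show ?thesis by (simp add: d_def)
  next
    case False
    let ?v = "interpolant ?V x f (L - {i})"
    have K: "finite (L - {i})" "card (L - {i}) = n" using L i by auto
    have v: "?v \<in> ?V" "\<And>k. k \<in> L - {i} \<Longrightarrow> ?v (x k) = f k"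
      using interpolant_props[OF K False, where \<Omega> = \<Omega> and f = f] \<Omega> by auto
    \<comment> \<open>only the point left out contributes, since \<open>?v\<close> interpolates at the others\<close>
    have "d i * (?v (x i) - f i) = (\<Sum>k\<in>L. d k * (?v (x k) - f k))"
      using v(2) by (subst sum.remove[OF L(1) i]) simp
    also have "\<dots> = - e"
      using annihilate[OF v(1)] by (simp add: right_diff_distrib sum_subtractf e_def)
    finally have "d i * (?v (x i) - f i) * (d i * u (x i)) = - e * (d i * u (x i))" by simp
    moreover have "(?b i)\<^sup>2 = d i * d i"
      using s[OF i] by (simp add: d_def power2_eq_square algebra_simps)
    ultimately show ?thesis by (simp add: mult_ac)
  qed
  then have "(\<Sum>i\<in>L. (?b i)\<^sup>2 * (interpolant ?V x f (L - {i}) (x i) - f i) * u (x i)) =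
      - e * (\<Sum>i\<in>L. d i * u (x i))"
    by (simp add: sum_distrib_left)
  then show ?thesis using annihilate[OF u] by simp
qed

text \<open>
  The map \<open>(K, i) \<mapsto> (K \<union> {i}, i)\<close> is a bijection from pairs with \<open>i \<notin> K\<close> to pairs with \<open>i \<in> L\<close>.
\<close>
lemma sum_insert_regroup:
  fixes g :: "'a set \<Rightarrow> 'a \<Rightarrow> 'b::comm_monoid_add"
  assumes "finite I"
  shows "(\<Sum>K | K \<subseteq> I \<and> card K = n. \<Sum>i\<in>I - K. g K i) =
    (\<Sum>L | L \<subseteq> I \<and> card L = Suc n. \<Sum>i\<in>L. g (L - {i}) i)"
proof -
  have fin: "finite {K. K \<subseteq> I \<and> card K = k}" for k using assms by simp
  have sub: "finite K" if "K \<subseteq> I" for K using that assms finite_subset by blast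
  have "(\<Sum>K | K \<subseteq> I \<and> card K = n. \<Sum>i\<in>I - K. g K i) =
      (\<Sum>(K, i)\<in>Sigma {K. K \<subseteq> I \<and> card K = n} (\<lambda>K. I - K). g K i)"
    using fin assms by (intro sum.Sigma) auto
  also have "\<dots> = (\<Sum>(L, i)\<in>Sigma {L. L \<subseteq> I \<and> card L = Suc n} (\<lambda>L. L). g (L - {i}) i)"
    by (rule sum.reindex_bij_witness[where j = "\<lambda>(K, i). (insert i K, i)"
          and i = "\<lambda>(L, i). (L - {i}, i)"]) (auto simp: sub)
  also have "\<dots> = (\<Sum>L | L \<subseteq> I \<and> card L = Suc n. \<Sum>i\<in>L. g (L - {i}) i)"
    using fin sub by (intro sum.Sigma[symmetric]) auto
  finally show ?thesis .
qed

section \<open>Normal equations and minimality\<close>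

lemma normal_equations_interpolant_sum:
  assumes \<Omega>: "\<And>i. i \<in> {1..m} \<Longrightarrow> x i \<in> \<Omega>" and u: "u \<in> approx_space \<Omega> n \<beta>"
  shows "(\<Sum>K\<in>unisolvent_sets m n \<beta> x. \<Sum>i = 1..m. wls_coeff n \<beta> x \<omega> K *
    (\<omega> i * (interpolant (approx_space \<Omega> n \<beta>) x f K (x i) - f i) * u (x i))) = 0"
proof -
  define v where "v K = interpolant (approx_space \<Omega> n \<beta>) x f K" for K
  define h where "h K i = wls_coeff n \<beta> x \<omega> K * (\<omega> i * (v K (x i) - f i) * u (x i))" for K i
  have finU: "finite {K. K \<subseteq> {1..m} \<and> card K = n}" by simp
  have "(\<Sum>K\<in>unisolvent_sets m n \<beta> x. \<Sum>i = 1..m. h K i) =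
      (\<Sum>K\<in>unisolvent_sets m n \<beta> x. \<Sum>i\<in>{1..m} - K. h K i)"
  proof (rule sum.cong[OF refl])
    fix K assume "K \<in> unisolvent_sets m n \<beta> x"
    then have K: "K \<subseteq> {1..m}" "card K = n" "Determinant.det (colloc_mat n \<beta> x K) \<noteq> 0"
      by (auto simp: unisolvent_sets_def)
    have "v K (x i) = f i" if "i \<in> K" for i
      unfolding v_def
    proof (rule interpolant_props(2)[OF _ K(2,3) _ that])
      show "finite K" using K(1) finite_subset by blast
      show "x k \<in> \<Omega>" if "k \<in> K" for k using that K(1) \<Omega> by blast
    qed
    then show "(\<Sum>i = 1..m. h K i) = (\<Sum>i\<in>{1..m} - K. h K i)"
      by (intro sum.mono_neutral_right) (auto simp: h_def)
  qed
  \<comment> \<open>non-unisolvent sets have weight \<open>0\<close>; admitting them makes the index set closed under exchange\<close>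
  also have "\<dots> = (\<Sum>K | K \<subseteq> {1..m} \<and> card K = n. \<Sum>i\<in>{1..m} - K. h K i)"
    by (rule sum.mono_neutral_left[OF finU])
       (auto simp: unisolvent_sets_def h_def wls_coeff_def)
  also have "\<dots> = (\<Sum>L | L \<subseteq> {1..m} \<and> card L = Suc n. \<Sum>i\<in>L. h (L - {i}) i)"
    by (rule sum_insert_regroup) simp
  also have "\<dots> = 0"
  proof (rule sum.neutral, rule ballI)
    fix L assume "L \<in> {L. L \<subseteq> {1..m} \<and> card L = Suc n}"
    then have L: "L \<subseteq> {1..m}" "card L = Suc n" by auto
    have fin: "finite L" using L(1) finite_subset by blast
    \<comment> \<open>\<open>\<omega>\<^sub>i\<close> supplies the factor missing from the weight of \<open>L - {i}\<close>\<close>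
    have "(\<Sum>i\<in>L. h (L - {i}) i) = (\<Sum>i\<in>L. (\<Prod>k\<in>L. \<omega> k) *
        ((Determinant.det (colloc_mat n \<beta> x (L - {i})))\<^sup>2 * (v (L - {i}) (x i) - f i) * u (x i)))"
      by (intro sum.cong refl) (simp add: h_def wls_coeff_def prod.remove[OF fin] mult_ac)
    also have "\<dots> = 0"
      using exchange_sum_zero[OF fin L(2) _ u, of x f] L(1) \<Omega>
      unfolding v_def by (subst sum_distrib_left[symmetric]) (auto simp: subset_iff)
    finally show "(\<Sum>i\<in>L. h (L - {i}) i) = 0" .
  qed
  finally show ?thesis by (simp add: h_def v_def)
qed

text \<open>
  The mixed term of the expanded square is the inner product of the residual of \<open>v\<close> with an
  element of \<open>V\<close>.
\<close>
lemma wls_objective_pythagoras: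
  fixes \<omega> f :: "nat \<Rightarrow> real"
  assumes "(\<Sum>i\<in>I. \<omega> i * (v (x i) - f i) * (u (x i) - v (x i))) = 0"
  shows "(\<Sum>i\<in>I. \<omega> i * \<bar>u (x i) - f i\<bar>\<^sup>2) =
    (\<Sum>i\<in>I. \<omega> i * \<bar>v (x i) - f i\<bar>\<^sup>2) + (\<Sum>i\<in>I. \<omega> i * (u (x i) - v (x i))\<^sup>2)"
proof -
  have "(\<Sum>i\<in>I. \<omega> i * \<bar>u (x i) - f i\<bar>\<^sup>2) =
      (\<Sum>i\<in>I. \<omega> i * \<bar>v (x i) - f i\<bar>\<^sup>2 + \<omega> i * (u (x i) - v (x i))\<^sup>2 +
        2 * (\<omega> i * (v (x i) - f i) * (u (x i) - v (x i))))"
    by (intro sum.cong refl) (simp add: power2_eq_square algebra_simps)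
  also have "\<dots> = (\<Sum>i\<in>I. \<omega> i * \<bar>v (x i) - f i\<bar>\<^sup>2) + (\<Sum>i\<in>I. \<omega> i * (u (x i) - v (x i))\<^sup>2)
      + 2 * (\<Sum>i\<in>I. \<omega> i * (v (x i) - f i) * (u (x i) - v (x i)))"
    by (simp only: sum.distrib sum_distrib_left)
  finally show ?thesis using assms by simp
qed

theorem theorem1:
  fixes \<Omega> :: "(real ^ 'N) set" and m n :: nat
    and x :: "nat \<Rightarrow> real ^ 'N" and f \<omega> :: "nat \<Rightarrow> real"
    and \<beta> :: "nat \<Rightarrow> real ^ 'N \<Rightarrow> real" and V :: "(real ^ 'N \<Rightarrow> real) set"
  assumes points: "\<And>i. i \<in> {1..m} \<Longrightarrow> x i \<in> \<Omega>"
    and weights: "\<And>i. i \<in> {1..m} \<Longrightarrow> \<omega> i > 0"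
    and V: "V = approx_space \<Omega> n \<beta>"
    and dim: "fun_space.dim V = n"
    and le: "n \<le> m"
    and unisolvent: "unisolvent_sets m n \<beta> x \<noteq> {}"
  shows "(\<exists>!v. wls_approximant V m x f \<omega> v) \<and>
    (\<forall>v. wls_approximant V m x f \<omega> v \<longrightarrow>
      (\<forall>y\<in>\<Omega>. v y =
        (\<Sum>K\<in>unisolvent_sets m n \<beta> x. wls_coeff n \<beta> x \<omega> K * interpolant V x f K y) /
        (\<Sum>K\<in>unisolvent_sets m n \<beta> x. wls_coeff n \<beta> x \<omega> K)))"
proof -
  define U where "U = unisolvent_sets m n \<beta> x"
  define l where "l = wls_coeff n \<beta> x \<omega>"
  define S where "S = (\<Sum>K\<in>U. l K)"
  define v where "v y = (\<Sum>K\<in>U. l K * interpolant V x f K y) / S" for y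
  define Q where "Q u = (\<Sum>i = 1..m. \<omega> i * \<bar>u (x i) - f i\<bar>\<^sup>2)" for u
  have U: "K \<subseteq> {1..m}" "finite K" "card K = n" "Determinant.det (colloc_mat n \<beta> x K) \<noteq> 0"
    "\<And>i. i \<in> K \<Longrightarrow> x i \<in> \<Omega>" if "K \<in> U" for K
    using that points by (auto simp: U_def unisolvent_sets_def intro: finite_subset)
  have "finite U"
    by (rule finite_subset[of _ "Pow {1..m}"]) (auto simp: U_def unisolvent_sets_def)
  moreover have "l K > 0" if "K \<in> U" for K
    using U[OF that] weights by (auto simp: l_def wls_coeff_def intro!: mult_pos_pos prod_pos)
  ultimately have S: "S > 0"
    using unisolvent unfolding S_def by (intro sum_pos) (auto simp: U_def)
  have vV: "v \<in> V"
  proof -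
    have "(\<lambda>y. \<Sum>K\<in>U. (l K / S) * interpolant V x f K y) \<in> V"
      unfolding V using U by (intro approx_space_lincomb interpolant_props) auto
    moreover have "v = (\<lambda>y. \<Sum>K\<in>U. (l K / S) * interpolant V x f K y)"
      by (simp add: v_def fun_eq_iff sum_divide_distrib)
    ultimately show ?thesis by simp
  qed
  have orth: "(\<Sum>i = 1..m. \<omega> i * (v (x i) - f i) * u (x i)) = 0" if "u \<in> V" for u
  proof -
    have scaled: "S * (v y - c) = (\<Sum>K\<in>U. l K * (interpolant V x f K y - c))" for y c
    proof -
      have "S * v y = (\<Sum>K\<in>U. l K * interpolant V x f K y)"
        using S by (simp add: v_def)
      then show ?thesis
        by (simp add: right_diff_distrib sum_subtractf S_def sum_distrib_right)
    qed
    have "S * (\<Sum>i = 1..m. \<omega> i * (v (x i) - f i) * u (x i)) =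
        (\<Sum>i = 1..m. \<omega> i * (S * (v (x i) - f i)) * u (x i))"
      by (simp add: sum_distrib_left mult_ac)
    also have "\<dots> =
        (\<Sum>i = 1..m. \<omega> i * (\<Sum>K\<in>U. l K * (interpolant V x f K (x i) - f i)) * u (x i))"
      by (simp only: scaled)
    also have "\<dots> = (\<Sum>K\<in>U. \<Sum>i = 1..m. l K * (\<omega> i * (interpolant V x f K (x i) - f i) * u (x i)))"
      by (subst sum.swap) (simp add: sum_distrib_left sum_distrib_right mult_ac)
    also have "\<dots> = 0"
      using normal_equations_interpolant_sum[of m x \<Omega> u n \<beta> \<omega> f] points that
      by (simp add: U_def l_def V)
    finally show ?thesis using S by simp
  qed
  have pyth: "Q u = Q v + (\<Sum>i = 1..m. \<omega> i * (u (x i) - v (x i))\<^sup>2)" if "u \<in> V" for u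
    using orth[of "\<lambda>y. u y - v y"] approx_space_diff[of u \<Omega> n \<beta> v] that vV
    unfolding Q_def V by (intro wls_objective_pythagoras) simp
  have nonneg: "(\<Sum>i = 1..m. \<omega> i * (u (x i) - v (x i))\<^sup>2) \<ge> 0" for u
    using weights by (intro sum_nonneg mult_nonneg_nonneg) (auto simp: less_imp_le)
  have wls: "wls_approximant V m x f \<omega> u \<longleftrightarrow> u \<in> V \<and> (\<forall>w\<in>V. Q u \<le> Q w)" for u
    by (auto simp: wls_approximant_def is_arg_min_def Q_def not_less)
  have min: "wls_approximant V m x f \<omega> v"
    unfolding wls
  proof (intro conjI ballI vV)
    show "Q v \<le> Q w" if "w \<in> V" for w
      using pyth[OF that] nonneg[of w] by linarith
  qed
  have uniq: "u = v" if "wls_approximant V m x f \<omega> u" for u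
  proof -
    from that have u: "u \<in> V" "Q u \<le> Q v" using vV by (auto simp: wls)
    then have "(\<Sum>i = 1..m. \<omega> i * (u (x i) - v (x i))\<^sup>2) = 0"
      using pyth[OF u(1)] nonneg[of u] by linarith
    then have zero: "\<forall>i\<in>{1..m}. \<omega> i * (u (x i) - v (x i))\<^sup>2 = 0"
      using weights by (subst (asm) sum_nonneg_eq_0_iff) (auto simp: less_imp_le)
    then have agree: "u (x i) - v (x i) = 0" if "i \<in> {1..m}" for i
    proof -
      have "\<omega> i * (u (x i) - v (x i))\<^sup>2 = 0" using zero that by blast
      with weights[OF that] show ?thesis by simp
    qed
    obtain K where K: "K \<in> U" using unisolvent by (auto simp: U_def)
    have mem: "(\<lambda>y. u y - v y) \<in> approx_space \<Omega> n \<beta>"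
      using approx_space_diff u(1) vV by (auto simp: V)
    have "u y - v y = 0" for y
    proof (rule vanishing_on_unisolvent_imp_zero[OF U(2,3,4)[OF K] U(5)[OF K] mem])
      show "u (x i) - v (x i) = 0" if "i \<in> K" for i
        using agree U(1)[OF K] that by blast
    qed
    then show ?thesis by (simp add: fun_eq_iff)
  qed
  show ?thesis
    using min uniq unfolding v_def S_def U_def l_def by auto
qed

end
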